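(* Let $f:\mathbb{R}^n\to\mathbb{R}$ be $L$-smooth and $\mu$-strongly convex with $L>\mu>0$, let $g:\mathbb{R}^n\to(-\infty,\infty]$ be closed, proper and convex, let $F=f+g$, let $x^\star$ be the unique minimizer of $F$ and $F^\star=F(x^\star)$. Let $\{x_k\}$, $\{y_k\}$ be generated by the accelerated proximal gradient (APG) method with step size $s\in(0,1/L)$, initial point $x_0=y_0\in\mathbb{R}^n$ and a parameter sequence $\{t_k\}_{k\ge 1}$ satisfying Nesterov's rule, and let $\{\mathcal{E}_k\}$ be the associated Lyapunov sequence (see context). Put $$\rho:=1-\frac{(1-Ls)\mu s}{3}\in(1-\mu s,1).$$ Then $\mathcal{E}_{k+1}\le\rho\,\mathcal{E}_k$ for all $k\ge 0$, and $$F(x_k)-F^\star\le\frac{\rho^k\|x_0-x^\star\|^2}{2s(t_{k+1}-1)t_{k+1}}\qquad\text{for all }k\ge 1.$$ Moreover, if $\{t_k\}$ is given by $t_1=1$, $t_{k+1}=\frac{1+\sqrt{1+4t_k^2}}{2}$ for all $k\ge1$, or by $t_{k+1}=\frac{k+r}{r}$ for all $k\ge 0$ with a constant $r\ge 2$, then $F(x_k)-F^\star\le\mathcal{O}(\rho^k/k^2)$, i.e. there is a constant $C$ (independent of $k$) with $F(x_k)-F^\star\le C\rho^k/k^2$ for all $k\ge1$.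
   Context: $\|\cdot\|$ is the Euclidean norm. $f$ is $L$-smooth if it is differentiable with $L$-Lipschitz gradient; $f$ is $\mu$-strongly convex if $f-\frac{\mu}{2}\|\cdot\|^2$ is convex. Proximal map: $\mathrm{prox}_{sg}(y)=\arg\min_{z\in\mathbb{R}^n}\{\frac12\|y-z\|^2+s\,g(z)\}$. Nesterov's rule for $\{t_k\}_{k\ge1}$: $t_1=1$, $t_{k+1}>t_k$, $t_k\to\infty$, and $t_{k+1}^2-t_{k+1}\le t_k^2$ for all $k\ge1$. APG method: with $y_0=x_0$, for $k=0,1,2,\dots$, $$x_{k+1}=\mathrm{prox}_{sg}(y_k-s\nabla f(y_k)),\qquad \beta_{k+1}=\frac{t_{k+1}-1}{t_{k+2}},\qquad y_{k+1}=x_{k+1}+\beta_{k+1}(x_{k+1}-x_k).$$ Lyapunov sequence: for $k\ge 0$, $$\mathcal{E}_k:=s(t_{k+1}-1)t_{k+1}\big(F(x_k)-F^\star\big)+\tfrac12\big\|(t_{k+1}-1)(y_k-x_k)+(y_k-x^\star)\big\|^2,$$ where for $k=0$ the first term is $0$ because $t_1=1$ (with the convention $0\cdot\infty=0$). *)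

theory Defs
  imports "HOL-Analysis.Analysis"
begin

definition gradient :: "('a::real_inner \<Rightarrow> real) \<Rightarrow> 'a \<Rightarrow> 'a" where
  "gradient f x = (THE D. GDERIV f x :> D)"

definition smooth_with :: "real \<Rightarrow> ('a::real_inner \<Rightarrow> real) \<Rightarrow> bool" where
  "smooth_with L f \<longleftrightarrow> (\<forall>x. f differentiable (at x)) \<and> L-lipschitz_on UNIV (gradient f)"

definition strongly_convex :: "real \<Rightarrow> ('a::real_normed_vector \<Rightarrow> real) \<Rightarrow> bool" where
  "strongly_convex \<mu> f \<longleftrightarrow> convex_on UNIV (\<lambda>x. f x - \<mu> / 2 * (norm x)\<^sup>2)"

text \<open>The library's epigraph is for real-valued functions only. For an extended-valued function
  it is taken in the product with the real line, so that points where the function is infinite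
  do not contribute; convexity and closedness are those of this set.\<close>

definition ereal_epigraph :: "('a \<Rightarrow> ereal) \<Rightarrow> ('a \<times> real) set" where
  "ereal_epigraph g = {(x, r). g x \<le> ereal r}"

definition proper_fun :: "('a \<Rightarrow> ereal) \<Rightarrow> bool" where
  "proper_fun g \<longleftrightarrow> (\<forall>x. g x \<noteq> -\<infinity>) \<and> (\<exists>x. g x \<noteq> \<infinity>)"

definition closed_fun :: "('a::topological_space \<Rightarrow> ereal) \<Rightarrow> bool" where
  "closed_fun g \<longleftrightarrow> closed (ereal_epigraph g)"

definition convex_fun :: "('a::real_vector \<Rightarrow> ereal) \<Rightarrow> bool" where
  "convex_fun g \<longleftrightarrow> convex (ereal_epigraph g)"

definition composite :: "('a \<Rightarrow> real) \<Rightarrow> ('a \<Rightarrow> ereal) \<Rightarrow> 'a \<Rightarrow> ereal" where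
  "composite f g x = ereal (f x) + g x"

definition prox :: "real \<Rightarrow> ('a::real_normed_vector \<Rightarrow> ereal) \<Rightarrow> 'a \<Rightarrow> 'a" where
  "prox s g y = arg_min (\<lambda>z. ereal (1 / 2 * (norm (y - z))\<^sup>2) + ereal s * g z) (\<lambda>_. True)"

text \<open>Parameter sequences are indexed from 1; the value at 0 is never used.\<close>

definition nesterov_rule :: "(nat \<Rightarrow> real) \<Rightarrow> bool" where
  "nesterov_rule t \<longleftrightarrow>
     t 1 = 1 \<and> (\<forall>k\<ge>1. t k < t (k + 1)) \<and> filterlim t at_top sequentially \<and>
     (\<forall>k\<ge>1. (t (k + 1))\<^sup>2 - t (k + 1) \<le> (t k)\<^sup>2)"

definition apg_sequence ::
    "('a::real_inner \<Rightarrow> real) \<Rightarrow> ('a \<Rightarrow> ereal) \<Rightarrow> real \<Rightarrow> (nat \<Rightarrow> real) \<Rightarrow>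
     (nat \<Rightarrow> 'a) \<Rightarrow> (nat \<Rightarrow> 'a) \<Rightarrow> bool" where
  "apg_sequence f g s t x y \<longleftrightarrow>
     y 0 = x 0 \<and>
     (\<forall>k. x (k + 1) = prox s g (y k - s *\<^sub>R gradient f (y k)) \<and>
          y (k + 1) = x (k + 1) + ((t (k + 1) - 1) / t (k + 2)) *\<^sub>R (x (k + 1) - x k))"

text \<open>The starting point need not lie in the domain of g, so the value is extended real; at k = 0
  the first term vanishes even then because multiplication on ereal satisfies 0 * \<infinity> = 0.\<close>

definition lyapunov ::
    "('a::real_inner \<Rightarrow> real) \<Rightarrow> ('a \<Rightarrow> ereal) \<Rightarrow> real \<Rightarrow> (nat \<Rightarrow> real) \<Rightarrow>
     (nat \<Rightarrow> 'a) \<Rightarrow> (nat \<Rightarrow> 'a) \<Rightarrow> 'a \<Rightarrow> nat \<Rightarrow> ereal" where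
  "lyapunov f g s t x y xstar k =
     ereal (s * (t (k + 1) - 1) * t (k + 1)) * (composite f g (x k) - composite f g xstar) +
     ereal (1 / 2 * (norm ((t (k + 1) - 1) *\<^sub>R (y k - x k) + (y k - xstar)))\<^sup>2)"

end

theory Submission
  imports Defs
begin

text \<open>Quadratic growth of a strongly convex function around its minimizer, applied to the objective
  defining the proximal map, replaces the subgradient inequality for \<open>g\<close>. Together with the
  descent lemma and the strongly convex tangent bound for \<open>f\<close>, a step from \<open>y\<close> to \<open>x'\<close> with
  \<open>q = y - x'\<close> satisfies
  \<open>s (F x' - F z) \<le> q \<bullet> (y - z) - (1 - L s / 2) |q|\<^sup>2 - (\<mu> s / 2) |y - z|\<^sup>2\<close> for all \<open>z\<close>.
  Writing \<open>u\<close> for the vector in \<open>\<E>\<^sub>k\<close>, so that the one in the next step is \<open>u - t q\<close>, the choices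
  \<open>z = x\<^sub>k\<close> and \<open>z = x\<^sup>\<star>\<close> give a decrease of at least \<open>a w + m v\<close>, where \<open>w = t\<^sup>2 |q|\<^sup>2 / 2\<close>,
  \<open>v = |u|\<^sup>2 / 2\<close>, \<open>a = 1 - L s\<close> and \<open>m = \<mu> s\<close>. The new Lyapunov value, rather than the old one,
  is controlled by the same quantities, namely by \<open>w / m + (1 + 1 / a) v\<close>; comparing the two bounds
  yields the factor \<open>1 - a m / 3\<close>.\<close>

section \<open>Strongly convex extended-valued functions\<close>

definition effective_domain :: "('a \<Rightarrow> ereal) \<Rightarrow> 'a set" where
  "effective_domain g = {x. g x \<noteq> \<infinity>}"

lemma proper_fun_real:
  assumes "proper_fun g" "x \<in> effective_domain g"
  shows "g x = ereal (real_of_ereal (g x))"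
  using assms by (cases "g x") (auto simp: proper_fun_def effective_domain_def)

text \<open>Convexity of the epigraph is applied to the two graph points \<open>(x, g x)\<close> and
  \<open>(y, g y)\<close>; the resulting bound is finite, so it also shows that the effective domain
  is convex.\<close>

lemma convex_on_effective_domain:
  fixes g :: "'a::real_vector \<Rightarrow> ereal"
  assumes "proper_fun g" "convex_fun g"
  shows "convex_on (effective_domain g) (\<lambda>x. real_of_ereal (g x))"
proof -
  have key: "g (u *\<^sub>R x + v *\<^sub>R y) \<le> ereal (u * real_of_ereal (g x) + v * real_of_ereal (g y))"
    if "x \<in> effective_domain g" "y \<in> effective_domain g" "0 \<le> u" "0 \<le> v" "u + v = 1" for x y u v
  proof -
    have "(x, real_of_ereal (g x)) \<in> ereal_epigraph g" "(y, real_of_ereal (g y)) \<in> ereal_epigraph g"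
      using that proper_fun_real[OF assms(1)] by (auto simp: ereal_epigraph_def)
    then have "u *\<^sub>R (x, real_of_ereal (g x)) + v *\<^sub>R (y, real_of_ereal (g y)) \<in> ereal_epigraph g"
      using assms(2) that unfolding convex_fun_def by (meson convexD)
    then show ?thesis by (simp add: ereal_epigraph_def)
  qed
  have conv: "convex (effective_domain g)"
    using key by (fastforce simp: convex_def effective_domain_def)
  show ?thesis
    unfolding convex_on_def
  proof (intro conjI ballI allI impI conv)
    fix x y u v
    assume *: "x \<in> effective_domain g" "y \<in> effective_domain g" "(0::real) \<le> u" "0 \<le> v" "u + v = 1"
    then have "u *\<^sub>R x + v *\<^sub>R y \<in> effective_domain g"
      using conv by (meson convexD)
    then show "real_of_ereal (g (u *\<^sub>R x + v *\<^sub>R y)) \<le> u * real_of_ereal (g x) + v * real_of_ereal (g y)"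
      using key[OF *] proper_fun_real[OF assms(1)] by (metis ereal_less_eq(3))
  qed
qed

lemma composite_real:
  assumes "proper_fun g" "x \<in> effective_domain g"
  shows "composite h g x = ereal (h x + real_of_ereal (g x))"
  unfolding composite_def by (subst proper_fun_real[OF assms]) simp

lemma composite_eq_infinity_iff: "composite h g x = \<infinity> \<longleftrightarrow> x \<notin> effective_domain g"
  by (simp add: composite_def effective_domain_def)

text \<open>The epigraph of \<open>h + g\<close> is the preimage of that of \<open>g\<close> under
  the continuous shear sending \<open>(x, r)\<close> to \<open>(x, r - h x)\<close>.\<close>

lemma closed_fun_composite:
  fixes h :: "'a::topological_space \<Rightarrow> real"
  assumes "continuous_on UNIV h" "closed_fun g"
  shows "closed_fun (composite h g)"
proof -
  have "ereal_epigraph (composite h g) = (\<lambda>p. (fst p, snd p - h (fst p))) -` ereal_epigraph g"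
  proof (intro set_eqI, clarsimp simp: ereal_epigraph_def composite_def)
    fix x r
    show "ereal (h x) + g x \<le> ereal r \<longleftrightarrow> g x \<le> ereal (r - h x)"
      by (cases "g x") auto
  qed
  moreover have "continuous_on UNIV (\<lambda>p::'a \<times> real. (fst p, snd p - h (fst p)))"
    by (intro continuous_intros continuous_on_compose2[OF assms(1)]) auto
  ultimately show ?thesis
    using assms(2) unfolding closed_fun_def by (metis closed_vimage)
qed

text \<open>The sublevel sets at the attained values are closed and nested: finitely many of them
  all contain the point with the least of those values. Compactness gives a point common to all of
  them, and this is a minimizer.\<close>

lemma closed_fun_attains_min:
  fixes F :: "'a::t2_space \<Rightarrow> ereal"
  assumes "closed_fun F" "\<And>x. F x \<noteq> -\<infinity>" "compact K" "K \<noteq> {}"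
  shows "\<exists>z\<in>K. \<forall>x\<in>K. F z \<le> F x"
proof -
  define S where "S x = K \<inter> {w. F w \<le> F x}" for x
  have closed_S: "closed (S x)" for x
  proof (cases "F x")
    case (real r)
    have "{w. F w \<le> F x} = (\<lambda>w. (w, r)) -` ereal_epigraph F"
      by (auto simp: ereal_epigraph_def real)
    moreover have "continuous_on UNIV (\<lambda>w::'a. (w, r))"
      by (intro continuous_intros)
    ultimately have "closed {w. F w \<le> F x}"
      using assms(1) unfolding closed_fun_def by (metis closed_vimage)
    then show ?thesis
      using assms(3) compact_imp_closed unfolding S_def by blast
  qed (use assms compact_imp_closed in \<open>auto simp: S_def\<close>)
  have "K \<inter> \<Inter>(S ` K) \<noteq> {}"
  proof (rule compact_imp_fip[OF assms(3)])
    fix \<F> assume "finite \<F>" "\<F> \<subseteq> S ` K"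
    then obtain X where X: "finite X" "X \<subseteq> K" "\<F> = S ` X"
      by (meson finite_subset_image)
    show "K \<inter> \<Inter>\<F> \<noteq> {}"
    proof (cases "X = {}")
      case False
      then have "Min (F ` X) \<in> F ` X"
        using X(1) by (intro Min_in) auto
      then obtain w where "w \<in> X" "F w = Min (F ` X)"
        by force
      then have "w \<in> K \<inter> \<Inter>\<F>"
        using X by (auto simp: S_def)
      then show ?thesis by blast
    qed (use X assms(4) in auto)
  qed (use closed_S in auto)
  then show ?thesis
    unfolding S_def by blast
qed

section \<open>Strong convexity along segments and growth around a minimizer\<close>

lemma strong_convexity_inequality:
  fixes \<phi> :: "'a::real_inner \<Rightarrow> real"
  assumes "convex_on D (\<lambda>x. \<phi> x - m / 2 * (norm x)\<^sup>2)" "a \<in> D" "b \<in> D" "0 \<le> l" "l \<le> 1"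
  shows "\<phi> ((1 - l) *\<^sub>R a + l *\<^sub>R b) \<le>
    (1 - l) * \<phi> a + l * \<phi> b - m / 2 * l * (1 - l) * (norm (b - a))\<^sup>2"
proof -
  \<comment> \<open>On a segment the squared norm falls short of its linear interpolation by exactly
    \<open>l * (1 - l) * (norm (b - a))\<^sup>2\<close>; this is the source of the extra
    term.\<close>
  have "(norm ((1 - l) *\<^sub>R a + l *\<^sub>R b))\<^sup>2 =
      (1 - l) * (norm a)\<^sup>2 + l * (norm b)\<^sup>2 - l * (1 - l) * (norm (b - a))\<^sup>2"
    unfolding power2_norm_eq_inner
    by (simp add: inner_simps inner_commute) (simp add: algebra_simps power2_eq_square)
  then have "m / 2 * (norm ((1 - l) *\<^sub>R a + l *\<^sub>R b))\<^sup>2 =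
      m / 2 * ((1 - l) * (norm a)\<^sup>2 + l * (norm b)\<^sup>2 - l * (1 - l) * (norm (b - a))\<^sup>2)"
    by simp
  also have "\<dots> = (1 - l) * (m / 2 * (norm a)\<^sup>2) + l * (m / 2 * (norm b)\<^sup>2) -
      m / 2 * l * (1 - l) * (norm (b - a))\<^sup>2"
    by (simp add: field_simps)
  finally show ?thesis
    using convex_onD[OF assms(1,4,5,2,3)] unfolding right_diff_distrib by linarith
qed

text \<open>Minimality of \<open>z\<close> is compared with strong convexity at the point a fraction
  \<open>l\<close> of the way to \<open>w\<close>; dividing by \<open>l\<close> and letting
  \<open>l\<close> tend to 0 from the right leaves the full quadratic term.\<close>

lemma quadratic_growth:
  fixes \<phi> :: "'a::real_inner \<Rightarrow> real"
  assumes conv: "convex_on D (\<lambda>x. \<phi> x - m / 2 * (norm x)\<^sup>2)"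
    and z: "z \<in> D" "\<And>x. x \<in> D \<Longrightarrow> \<phi> z \<le> \<phi> x" and "w \<in> D"
  shows "\<phi> z + m / 2 * (norm (w - z))\<^sup>2 \<le> \<phi> w"
proof -
  define c where "c = m / 2 * (norm (w - z))\<^sup>2"
  have *: "c * (1 - l) \<le> \<phi> w - \<phi> z" if "0 < l" "l < 1" for l :: real
  proof -
    have "(1 - l) *\<^sub>R z + l *\<^sub>R w \<in> D"
      using conv z(1) \<open>w \<in> D\<close> that
      by (intro convexD) (auto simp: convex_on_imp_convex)
    then have "\<phi> z \<le> (1 - l) * \<phi> z + l * \<phi> w - m / 2 * l * (1 - l) * (norm (w - z))\<^sup>2"
      using strong_convexity_inequality[OF conv z(1) \<open>w \<in> D\<close>, of l] z(2) that by force
    then have "l * (c * (1 - l)) \<le> l * (\<phi> w - \<phi> z)"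
      by (simp add: c_def algebra_simps)
    then show ?thesis using that by simp
  qed
  have "((\<lambda>l. c * (1 - l)) \<longlongrightarrow> c * (1 - 0)) (at_right 0)"
    by (intro tendsto_intros)
  moreover have "eventually (\<lambda>l. c * (1 - l) \<le> \<phi> w - \<phi> z) (at_right 0)"
    using eventually_at_right_real[of 0 1] by (rule eventually_mono) (auto intro: *)
  ultimately have "c * (1 - 0) \<le> \<phi> w - \<phi> z"
    by (intro tendsto_upperbound) auto
  then show ?thesis by (simp add: c_def)
qed

section \<open>Minimizers of the composite function \<open>h + g\<close>\<close>

lemma convex_on_composite:
  assumes "proper_fun g" "convex_fun g" "strongly_convex m h"
  shows "convex_on (effective_domain g) (\<lambda>x. h x + real_of_ereal (g x) - m / 2 * (norm x)\<^sup>2)"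
proof -
  have D: "convex_on (effective_domain g) (\<lambda>x. real_of_ereal (g x))"
    by (rule convex_on_effective_domain[OF assms(1,2)])
  then have "convex_on (effective_domain g) (\<lambda>x. h x - m / 2 * (norm x)\<^sup>2)"
    using assms(3) unfolding strongly_convex_def
    by (meson convex_on_imp_convex convex_on_subset subset_UNIV)
  from convex_on_add[OF this D] show ?thesis
    by (simp add: algebra_simps)
qed

text \<open>Reduces extended-valued minimization to real arithmetic on the effective domain:
  properness supplies a finite value, so a minimizer cannot have value \<infinity>.\<close>

lemma is_arg_min_composite_iff:
  assumes "proper_fun g"
  shows "is_arg_min (composite h g) (\<lambda>_. True) z \<longleftrightarrow>
    z \<in> effective_domain g \<and>
    (\<forall>w\<in>effective_domain g. h z + real_of_ereal (g z) \<le> h w + real_of_ereal (g w))"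
    (is "?l \<longleftrightarrow> ?r")
proof
  assume l: ?l
  then have le: "composite h g z \<le> composite h g w" for w
    by (auto simp: is_arg_min_def not_less)
  obtain w where "w \<in> effective_domain g"
    using assms by (auto simp: proper_fun_def effective_domain_def)
  then have "composite h g z \<noteq> \<infinity>"
    using le[of w] composite_eq_infinity_iff[of h g w] by auto
  then have z: "z \<in> effective_domain g"
    by (simp add: composite_eq_infinity_iff)
  then show ?r
    using le composite_real[OF assms, of _ h] by (metis ereal_less_eq(3))
next
  assume r: ?r
  have "composite h g z \<le> composite h g w" for w
  proof (cases "w \<in> effective_domain g")
    case True
    then show ?thesis using r composite_real[OF assms, of _ h] by simp
  next
    case False
    then have "composite h g w = \<infinity>" by (simp add: composite_eq_infinity_iff)
    then show ?thesis by simp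
  qed
  then show ?l by (simp add: is_arg_min_def not_less)
qed

text \<open>The minimum over a unit ball around a point of the domain controls the whole function from
  below: along each ray, strong convexity forces growth that eventually beats the linear term.\<close>

lemma strongly_convex_composite_ex1_min:
  fixes h :: "'a::euclidean_space \<Rightarrow> real"
  assumes cont: "continuous_on UNIV h" and sc: "strongly_convex m h" and "0 < m"
    and g: "closed_fun g" "proper_fun g" "convex_fun g"
  shows "\<exists>!z. is_arg_min (composite h g) (\<lambda>_. True) z"
proof -
  define F where "F = composite h g"
  define D where "D = effective_domain g"
  define \<phi> where "\<phi> x = h x + real_of_ereal (g x)" for x
  have conv: "convex_on D (\<lambda>x. \<phi> x - m / 2 * (norm x)\<^sup>2)"
    unfolding D_def \<phi>_def using convex_on_composite[OF g(2,3) sc] .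
  have F_real: "F x = ereal (\<phi> x)" if "x \<in> D" for x
    using composite_real[OF g(2)] that by (simp add: F_def D_def \<phi>_def)
  have F_inf: "F x = \<infinity>" if "x \<notin> D" for x
    using that by (simp add: F_def D_def composite_eq_infinity_iff)
  have F_ninf: "F x \<noteq> -\<infinity>" for x
    by (cases "x \<in> D") (auto simp: F_real F_inf)
  have closed: "closed_fun F"
    unfolding F_def by (rule closed_fun_composite[OF cont g(1)])
  obtain x0 where x0: "x0 \<in> D"
    using g(2) by (auto simp: proper_fun_def D_def effective_domain_def)
  obtain z1 where z1: "z1 \<in> cball x0 1" "\<And>x. x \<in> cball x0 1 \<Longrightarrow> F z1 \<le> F x"
    using closed_fun_attains_min[OF closed F_ninf compact_cball, of x0 1] by auto
  have "F z1 \<le> F x0" using z1(2)[of x0] by simp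
  then have "F z1 \<noteq> \<infinity>" using F_real[OF x0] by auto
  then have z1D: "z1 \<in> D" using F_inf by blast
  then have le: "\<phi> z1 \<le> \<phi> x0" using \<open>F z1 \<le> F x0\<close> F_real x0 by simp
  \<comment> \<open>Chosen so that for \<open>d > R\<close> the growth
    \<open>m / 2 * (d - 1)\<close> exceeds the possible drop \<open>\<phi> x0 - \<phi> z1\<close> on
    the unit ball.\<close>
  define R where "R = 1 + 2 * (\<phi> x0 - \<phi> z1) / m"
  have R: "1 \<le> R" using le \<open>0 < m\<close> by (simp add: R_def)
  have far: "\<phi> x0 < \<phi> w" if "w \<in> D" "R < norm (w - x0)" for w
  proof -
    define d where "d = norm (w - x0)"
    have d: "1 < d" using that R by (simp add: d_def)
    \<comment> \<open>The point at distance 1 from \<open>x0\<close> towards \<open>w\<close>: the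
      unit-ball minimum bounds \<open>\<phi> p\<close> from below, strong convexity bounds it from
      above in terms of \<open>\<phi> w\<close>.\<close>
    define p where "p = (1 - 1 / d) *\<^sub>R x0 + (1 / d) *\<^sub>R w"
    have "p \<in> D"
      unfolding p_def using conv x0 that(1) d
      by (intro convexD) (auto simp: convex_on_imp_convex)
    have "p - x0 = (1 / d) *\<^sub>R (w - x0)"
      by (simp add: p_def algebra_simps)
    then have "norm (p - x0) = 1"
      using d by (simp add: d_def[symmetric])
    then have "F z1 \<le> F p"
      by (intro z1(2)) (simp add: dist_norm norm_minus_commute)
    then have "\<phi> z1 \<le> \<phi> p"
      using F_real z1D \<open>p \<in> D\<close> by simp
    also have "\<phi> p \<le> (1 - 1 / d) * \<phi> x0 + 1 / d * \<phi> w - m / 2 * (1 / d) * (1 - 1 / d) * d\<^sup>2"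
      using strong_convexity_inequality[OF conv x0 that(1), of "1 / d"] d
      unfolding p_def d_def[symmetric] by simp
    finally have "d * \<phi> z1 \<le> d * ((1 - 1 / d) * \<phi> x0 + 1 / d * \<phi> w - m / 2 * (1 / d) * (1 - 1 / d) * d\<^sup>2)"
      using d by simp
    also have "\<dots> = (d - 1) * \<phi> x0 + \<phi> w - m / 2 * (d - 1) * d"
      using d by (simp add: field_simps power2_eq_square)
    finally have A: "d * (m / 2 * (d - 1) - (\<phi> x0 - \<phi> z1)) \<le> \<phi> w - \<phi> x0"
      by (simp add: algebra_simps)
    have "2 * (\<phi> x0 - \<phi> z1) / m < d - 1"
      using that(2) by (simp add: R_def d_def)
    then have "0 < m / 2 * (d - 1) - (\<phi> x0 - \<phi> z1)"
      using \<open>0 < m\<close> by (simp add: field_simps)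
    then have "0 < d * (m / 2 * (d - 1) - (\<phi> x0 - \<phi> z1))"
      using d by simp
    then show ?thesis using A by linarith
  qed
  obtain z where z: "z \<in> cball x0 R" "\<And>x. x \<in> cball x0 R \<Longrightarrow> F z \<le> F x"
    using closed_fun_attains_min[OF closed F_ninf compact_cball, of x0 R] R by auto
  have "F z \<le> F w" for w
  proof (cases "w \<in> D \<and> w \<notin> cball x0 R")
    case True
    then have "F x0 \<le> F w"
      using far[of w] F_real x0 by (simp add: dist_norm norm_minus_commute)
    moreover have "F z \<le> F x0" using z(2)[of x0] R by simp
    ultimately show ?thesis by (rule order_trans[rotated])
  next
    case False
    then show ?thesis using z(2)[of w] F_inf[of w] by auto
  qed
  then have ex: "is_arg_min F (\<lambda>_. True) z"
    by (simp add: is_arg_min_def not_less)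
  show ?thesis
    unfolding F_def[symmetric]
  proof (rule ex1I[of _ z])
    fix z' assume z': "is_arg_min F (\<lambda>_. True) z'"
    note min = ex[unfolded F_def is_arg_min_composite_iff[OF g(2)], folded D_def \<phi>_def]
      z'[unfolded F_def is_arg_min_composite_iff[OF g(2)], folded D_def \<phi>_def]
    have "\<phi> z + m / 2 * (norm (z' - z))\<^sup>2 \<le> \<phi> z'"
      using min by (intro quadratic_growth[OF conv]) auto
    moreover have "\<phi> z' \<le> \<phi> z" using min by blast
    ultimately have "m / 2 * (norm (z' - z))\<^sup>2 \<le> 0" by linarith
    then show "z' = z" using \<open>0 < m\<close> by (simp add: mult_le_0_iff)
  qed (rule ex)
qed

lemma ex1_is_arg_min_arg_min:
  "\<exists>!z. is_arg_min F P z \<Longrightarrow> is_arg_min F P (arg_min F P)"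
  unfolding arg_min_def by (rule someI_ex) blast

section \<open>Proximal maps\<close>

lemma ereal_mult_le_iff:
  assumes "0 < s"
  shows "ereal s * a \<le> ereal r \<longleftrightarrow> a \<le> ereal (r / s)"
  using assms by (cases a) (auto simp: field_simps)

text \<open>The map in this preimage is both continuous and linear, so one identity transfers
  closedness as well as convexity to \<open>s * g\<close>.\<close>

lemma ereal_epigraph_scale:
  assumes "0 < s"
  shows "ereal_epigraph (\<lambda>z. ereal s * g z) = (\<lambda>p. (fst p, snd p / s)) -` ereal_epigraph g"
  using assms by (auto simp: ereal_epigraph_def ereal_mult_le_iff)

lemma closed_fun_scale:
  fixes g :: "'a::topological_space \<Rightarrow> ereal"
  assumes "0 < s" "closed_fun g"
  shows "closed_fun (\<lambda>z. ereal s * g z)"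
proof -
  have "continuous_on UNIV (\<lambda>p::'a \<times> real. (fst p, snd p / s))"
    using assms(1) by (intro continuous_intros) auto
  then show ?thesis
    using assms(2) unfolding closed_fun_def ereal_epigraph_scale[OF assms(1)] by (metis closed_vimage)
qed

lemma convex_fun_scale:
  fixes g :: "'a::real_vector \<Rightarrow> ereal"
  assumes "0 < s" "convex_fun g"
  shows "convex_fun (\<lambda>z. ereal s * g z)"
proof -
  have "linear (\<lambda>p::'a \<times> real. (fst p, snd p / s))"
    by (rule linearI) (auto simp: add_divide_distrib)
  then show ?thesis
    using assms(2) unfolding convex_fun_def ereal_epigraph_scale[OF assms(1)]
    by (rule convex_linear_vimage)
qed

lemma effective_domain_scale:
  assumes "0 < s"
  shows "effective_domain (\<lambda>z. ereal s * g z) = effective_domain g"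
proof -
  have "ereal s * g z = \<infinity> \<longleftrightarrow> g z = \<infinity>" for z
    using assms by (cases "g z") auto
  then show ?thesis by (simp add: effective_domain_def)
qed

lemma proper_fun_scale:
  assumes "0 < s" "proper_fun g"
  shows "proper_fun (\<lambda>z. ereal s * g z)"
proof -
  have "ereal s * g z \<noteq> -\<infinity>" for z
    using assms by (cases "g z") (auto simp: proper_fun_def)
  moreover have "effective_domain (\<lambda>z. ereal s * g z) \<noteq> {}"
    using assms(2) unfolding effective_domain_scale[OF assms(1)]
    by (auto simp: proper_fun_def effective_domain_def)
  ultimately show ?thesis by (auto simp: proper_fun_def effective_domain_def)
qed

text \<open>Subtracting half the squared norm of \<open>z\<close> leaves an affine function of
  \<open>z\<close>.\<close>

lemma strongly_convex_half_dist_square: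
  fixes y :: "'a::real_inner"
  shows "strongly_convex 1 (\<lambda>z. 1 / 2 * (norm (y - z))\<^sup>2)"
proof -
  have "1 / 2 * (norm (y - z))\<^sup>2 - 1 / 2 * (norm z)\<^sup>2 = y \<bullet> y / 2 - y \<bullet> z" for z
    unfolding power2_norm_eq_inner by (simp add: inner_simps inner_commute field_simps)
  moreover have "convex_on UNIV (\<lambda>z. y \<bullet> y / 2 - y \<bullet> z)"
    by (intro convex_onI) (auto simp: inner_simps field_simps)
  ultimately show ?thesis by (simp add: strongly_convex_def)
qed

text \<open>The inequality says that \<open>(y - p) / s\<close> is a subgradient of \<open>g\<close>
  at \<open>p = prox s g y\<close>. It is quadratic growth with modulus 1 of the objective defining
  the proximal map; the three squared distances involved combine into one inner product.\<close>

lemma prox_in_effective_domain_ineq: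
  fixes g :: "'a::euclidean_space \<Rightarrow> ereal"
  assumes "0 < s" and g: "closed_fun g" "proper_fun g" "convex_fun g"
  shows "prox s g y \<in> effective_domain g"
    and "z \<in> effective_domain g \<Longrightarrow>
      (y - prox s g y) \<bullet> (z - prox s g y) \<le>
      s * (real_of_ereal (g z) - real_of_ereal (g (prox s g y)))"
proof -
  define h where "h z = 1 / 2 * (norm (y - z))\<^sup>2" for z
  define g' where "g' z = ereal s * g z" for z
  define p where "p = prox s g y"
  have sc: "strongly_convex 1 h"
    unfolding h_def by (rule strongly_convex_half_dist_square)
  have g': "closed_fun g'" "proper_fun g'" "convex_fun g'"
    and dom: "effective_domain g' = effective_domain g"
    unfolding g'_def using assms
    by (simp_all add: closed_fun_scale proper_fun_scale convex_fun_scale effective_domain_scale)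
  have real: "real_of_ereal (g' z) = s * real_of_ereal (g z)" for z
    by (simp add: g'_def)
  have "continuous_on UNIV h"
    unfolding h_def by (intro continuous_intros)
  then have "is_arg_min (composite h g') (\<lambda>_. True) (arg_min (composite h g') (\<lambda>_. True))"
    by (intro ex1_is_arg_min_arg_min strongly_convex_composite_ex1_min[OF _ sc]) (auto simp: g')
  moreover have "arg_min (composite h g') (\<lambda>_. True) = p"
    by (simp add: p_def prox_def composite_def[abs_def] h_def g'_def)
  ultimately have p: "p \<in> effective_domain g"
    "\<And>w. w \<in> effective_domain g \<Longrightarrow> h p + s * real_of_ereal (g p) \<le> h w + s * real_of_ereal (g w)"
    by (auto simp: is_arg_min_composite_iff[OF g'(2)] dom real)
  show "prox s g y \<in> effective_domain g" using p(1) by (simp add: p_def)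
  show "(y - prox s g y) \<bullet> (z - prox s g y) \<le>
      s * (real_of_ereal (g z) - real_of_ereal (g (prox s g y)))" if z: "z \<in> effective_domain g"
  proof -
    have "h p + s * real_of_ereal (g p) + 1 / 2 * (norm (z - p))\<^sup>2 \<le> h z + s * real_of_ereal (g z)"
      using quadratic_growth[OF convex_on_composite[OF g'(2,3) sc, unfolded dom real] p z] .
    moreover have "h p + 1 / 2 * (norm (z - p))\<^sup>2 - h z = (y - p) \<bullet> (z - p)"
      unfolding h_def power2_norm_eq_inner by (simp add: inner_simps inner_commute field_simps)
    ultimately show ?thesis by (simp add: p_def[symmetric] algebra_simps)
  qed
qed

section \<open>Smooth strongly convex functions\<close>

text \<open>As \<open>gradient\<close> is a definite description, both existence and uniqueness are
  required. Existence represents the derivative by its values on the finite basis; uniqueness is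
  that of the derivative.\<close>

lemma GDERIV_gradient:
  fixes f :: "'a::euclidean_space \<Rightarrow> real"
  assumes "f differentiable (at x)"
  shows "GDERIV f x :> gradient f x"
proof -
  obtain f' where f': "(f has_derivative f') (at x)"
    using assms by (auto simp: differentiable_def)
  then interpret linear f' by (rule has_derivative_linear)
  define D where "D = (\<Sum>b\<in>Basis. f' b *\<^sub>R b)"
  have "f' v = v \<bullet> D" for v
  proof -
    have "f' v = f' (\<Sum>b\<in>Basis. (v \<bullet> b) *\<^sub>R b)" by (simp add: euclidean_representation)
    also have "\<dots> = v \<bullet> D" by (simp add: sum scale D_def inner_sum_right mult.commute)
    finally show ?thesis .
  qed
  then have D: "GDERIV f x :> D"
    using f' unfolding gderiv_def by (metis (no_types, lifting) ext)
  show ?thesis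
    unfolding gradient_def
  proof (rule theI[of _ D])
    fix D' assume "GDERIV f x :> D'"
    then have "(\<lambda>v. v \<bullet> D') = (\<lambda>v. v \<bullet> D)"
      using D has_derivative_unique unfolding gderiv_def by blast
    then show "D' = D" by (metis vector_eq_ldot)
  qed (rule D)
qed

lemma GDERIV_along_line:
  assumes "GDERIV f (y + r *\<^sub>R d) :> D"
  shows "((\<lambda>r. f (y + r *\<^sub>R d)) has_real_derivative D \<bullet> d) (at r)"
proof -
  have "((\<lambda>r. y + r *\<^sub>R d) has_derivative (\<lambda>h. h *\<^sub>R d)) (at r)"
    by (auto intro!: derivative_eq_intros)
  moreover have "(f has_derivative (\<lambda>v. v \<bullet> D)) (at (y + r *\<^sub>R d))"
    using assms by (simp add: gderiv_def)
  ultimately have "((\<lambda>r. f (y + r *\<^sub>R d)) has_derivative (\<lambda>h. (h *\<^sub>R d) \<bullet> D)) (at r)"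
    by (rule has_derivative_compose)
  then show ?thesis
    by (simp add: has_field_derivative_def inner_commute mult_commute_abs)
qed

text \<open>Along the segment, \<open>q\<close> is \<open>f\<close> minus the claimed upper bound up
  to a constant. Cauchy-Schwarz and the Lipschitz gradient make its derivative nonpositive, and
  \<open>q 1 \<le> q 0\<close> is the claim.\<close>

lemma descent_lemma:
  fixes f :: "'a::euclidean_space \<Rightarrow> real"
  assumes "smooth_with L f"
  shows "f x \<le> f y + gradient f y \<bullet> (x - y) + L / 2 * (norm (x - y))\<^sup>2"
proof -
  define d where "d = x - y"
  define q where "q r = f (y + r *\<^sub>R d) - r * (gradient f y \<bullet> d) - L / 2 * r\<^sup>2 * (norm d)\<^sup>2" for r
  have "q 1 \<le> q 0"
  proof (rule DERIV_nonpos_imp_nonincreasing[of 0 1 q])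
    fix r :: real assume r: "0 \<le> r" "r \<le> 1"
    define e where "e = gradient f (y + r *\<^sub>R d) \<bullet> d - gradient f y \<bullet> d - L * r * (norm d)\<^sup>2"
    have der: "((\<lambda>r. f (y + r *\<^sub>R d)) has_real_derivative gradient f (y + r *\<^sub>R d) \<bullet> d) (at r)"
      using assms by (intro GDERIV_along_line GDERIV_gradient) (simp add: smooth_with_def)
    have "(q has_real_derivative e) (at r)"
      unfolding q_def e_def by (auto intro!: derivative_eq_intros der)
    moreover have "e \<le> 0"
    proof -
      have "gradient f (y + r *\<^sub>R d) \<bullet> d - gradient f y \<bullet> d = (gradient f (y + r *\<^sub>R d) - gradient f y) \<bullet> d"
        by (simp add: inner_simps)
      also have "\<dots> \<le> norm (gradient f (y + r *\<^sub>R d) - gradient f y) * norm d"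
        by (rule norm_cauchy_schwarz)
      also have "\<dots> \<le> (L * norm (r *\<^sub>R d)) * norm d"
        using assms lipschitz_onD[of L UNIV "gradient f" "y + r *\<^sub>R d" y]
        by (intro mult_right_mono) (auto simp: smooth_with_def dist_norm)
      also have "\<dots> = L * r * (norm d)\<^sup>2"
        using r by (simp add: power2_eq_square)
      finally show ?thesis by (simp add: e_def)
    qed
    ultimately show "\<exists>e. (q has_real_derivative e) (at r) \<and> e \<le> 0" by blast
  qed simp
  then show ?thesis by (simp add: q_def d_def)
qed

text \<open>The convex function \<open>h\<close>, which is \<open>f\<close> without its quadratic
  part, lies above its tangent along the line from \<open>y\<close> to \<open>z\<close>. Restoring
  the quadratic part turns the tangent error into the squared distance.\<close>

lemma strongly_convex_tangent:
  fixes f :: "'a::euclidean_space \<Rightarrow> real"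
  assumes "f differentiable (at y)" "strongly_convex \<mu> f"
  shows "f y + gradient f y \<bullet> (z - y) + \<mu> / 2 * (norm (z - y))\<^sup>2 \<le> f z"
proof -
  define d where "d = z - y"
  define h where "h v = f v - \<mu> / 2 * (norm v)\<^sup>2" for v
  have h: "convex_on UNIV h"
    using assms(2) unfolding strongly_convex_def h_def[abs_def] .
  have conv: "convex_on UNIV (\<lambda>r. h (y + r *\<^sub>R d))"
  proof (rule convex_onI)
    fix l a b :: real assume "0 < l" "l < 1"
    then have "h ((1 - l) *\<^sub>R (y + a *\<^sub>R d) + l *\<^sub>R (y + b *\<^sub>R d)) \<le>
        (1 - l) * h (y + a *\<^sub>R d) + l * h (y + b *\<^sub>R d)"
      by (intro convex_onD[OF h]) auto
    moreover have "(1 - l) *\<^sub>R (y + a *\<^sub>R d) + l *\<^sub>R (y + b *\<^sub>R d) = y + ((1 - l) *\<^sub>R a + l *\<^sub>R b) *\<^sub>R d"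
      by (simp add: algebra_simps)
    ultimately show "h (y + ((1 - l) *\<^sub>R a + l *\<^sub>R b) *\<^sub>R d) \<le>
        (1 - l) * h (y + a *\<^sub>R d) + l * h (y + b *\<^sub>R d)" by simp
  qed simp
  have sq: "(norm (y + r *\<^sub>R d))\<^sup>2 = (norm y)\<^sup>2 + 2 * r * (y \<bullet> d) + r\<^sup>2 * (norm d)\<^sup>2" for r
    unfolding power2_norm_eq_inner by (simp add: inner_simps inner_commute power2_eq_square algebra_simps)
  have "((\<lambda>r. f (y + r *\<^sub>R d)) has_real_derivative gradient f y \<bullet> d) (at 0)"
    using GDERIV_along_line[of f y 0 d "gradient f y"] GDERIV_gradient[OF assms(1)] by simp
  then have "((\<lambda>r. h (y + r *\<^sub>R d)) has_real_derivative gradient f y \<bullet> d - \<mu> * (y \<bullet> d)) (at 0)"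
    unfolding h_def sq by (auto intro!: derivative_eq_intros)
  then have "(gradient f y \<bullet> d - \<mu> * (y \<bullet> d)) * (1 - 0) \<le> h (y + 1 *\<^sub>R d) - h (y + 0 *\<^sub>R d)"
    by (intro convex_on_imp_above_tangent[OF conv]) auto
  then show ?thesis
    unfolding h_def sq by (simp add: algebra_simps d_def)
qed

text \<open>The gradient terms of the descent bound at \<open>x'\<close> and the tangent bound at
  \<open>z\<close> cancel against those of the proximal inequality. In the coefficient of the
  squared step, the 1 comes from the proximal map and \<open>L * s / 2\<close> from the descent
  lemma.\<close>

lemma prox_gradient_inequality:
  fixes f :: "'a::euclidean_space \<Rightarrow> real" and g :: "'a \<Rightarrow> ereal"
  assumes f: "smooth_with L f" "strongly_convex \<mu> f"
    and g: "closed_fun g" "proper_fun g" "convex_fun g" and "0 < s"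
    and x': "x' = prox s g (y - s *\<^sub>R gradient f y)"
    and z: "z \<in> effective_domain g"
  shows "s * ((f x' + real_of_ereal (g x')) - (f z + real_of_ereal (g z))) \<le>
    (y - x') \<bullet> (y - z) - (1 - L * s / 2) * (norm (y - x'))\<^sup>2 - \<mu> * s / 2 * (norm (y - z))\<^sup>2"
proof -
  define D where "D = gradient f y"
  have "f x' - f z \<le> D \<bullet> (x' - y) + L / 2 * (norm (x' - y))\<^sup>2 -
      (D \<bullet> (z - y) + \<mu> / 2 * (norm (z - y))\<^sup>2)"
    using descent_lemma[OF f(1), of x' y] strongly_convex_tangent[OF _ f(2), of y z] f(1)
    by (simp add: D_def smooth_with_def)
  then have "s * (f x' - f z) \<le> s * (D \<bullet> (x' - y) + L / 2 * (norm (x' - y))\<^sup>2 -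
      (D \<bullet> (z - y) + \<mu> / 2 * (norm (z - y))\<^sup>2))"
    using \<open>0 < s\<close> by simp
  moreover have "((y - s *\<^sub>R D) - x') \<bullet> (z - x') \<le> s * (real_of_ereal (g z) - real_of_ereal (g x'))"
    using prox_in_effective_domain_ineq(2)[OF \<open>0 < s\<close> g z, of "y - s *\<^sub>R D"] by (simp add: x' D_def)
  moreover have "((y - s *\<^sub>R D) - x') \<bullet> (z - x') =
      (norm (y - x'))\<^sup>2 - (y - x') \<bullet> (y - z) + s * (D \<bullet> (x' - y)) - s * (D \<bullet> (z - y))"
    unfolding power2_norm_eq_inner by (simp add: inner_simps inner_commute algebra_simps)
  ultimately show ?thesis
    by (simp add: norm_minus_commute algebra_simps)
qed

section \<open>The Lyapunov estimate\<close>

text \<open>Here \<open>a = 1 - L * s\<close>, \<open>m = \<mu> * s\<close> and \<open>q = y - x'\<close> for a proximal gradient step from \<open>y\<close> to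
  \<open>x'\<close>. The two inequalities are that step compared with the previous iterate \<open>x\<close> and with the
  minimizer \<open>p\<close>; they are combined with weights \<open>T * (T - 1)\<close> and \<open>T\<close>. For \<open>T = 1\<close> the first has
  weight zero, so it may fail when \<open>x\<close> lies outside the domain.\<close>

lemma lyapunov_contraction:
  fixes x y p q :: "'a::real_inner"
  assumes a: "0 < a" "a < 1" and m: "0 < m" "m < 1"
    and T: "1 \<le> T" "1 \<le> T'" "T'\<^sup>2 - T' \<le> T\<^sup>2" and "0 \<le> B"
    and prev: "1 < T \<Longrightarrow> B - A \<le> q \<bullet> (y - x) - (1 + a) / 2 * (norm q)\<^sup>2 - m / 2 * (norm (y - x))\<^sup>2"
    and opt: "B \<le> q \<bullet> (y - p) - (1 + a) / 2 * (norm q)\<^sup>2 - m / 2 * (norm (y - p))\<^sup>2"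
    and u: "u = (T - 1) *\<^sub>R (y - x) + (y - p)"
  shows "(T' - 1) * T' * B + 1 / 2 * (norm (u - T *\<^sub>R q))\<^sup>2 \<le>
    (1 - a * m / 3) * ((T - 1) * T * A + 1 / 2 * (norm u)\<^sup>2)"
proof -
  \<comment> \<open>\<open>E'\<close> has \<open>T\<^sup>2\<close> in place of
    \<open>(T' - 1) * T'\<close>, which makes it free of \<open>T'\<close>; Nesterov's rule and
    \<open>0 \<le> B\<close> turn the bound on it into one for the new Lyapunov value.\<close>
  define w v E E' where "w = T\<^sup>2 * (norm q)\<^sup>2 / 2" and "v = (norm u)\<^sup>2 / 2"
    and "E = (T - 1) * T * A + v" and "E' = T\<^sup>2 * B + 1 / 2 * (norm (u - T *\<^sub>R q))\<^sup>2"
  have wv: "0 \<le> w" "0 \<le> v" by (auto simp: w_def v_def)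
  have sq: "(norm (u - T *\<^sub>R q))\<^sup>2 = 2 * v - 2 * T * (q \<bullet> u) + 2 * w"
    unfolding v_def w_def power2_norm_eq_inner
    by (simp add: inner_simps inner_commute power2_eq_square)
  have decrease: "E' + a * w + m * v \<le> E"
  proof -
    have "T * (T - 1) * (B - A) \<le> T * (T - 1) *
        (q \<bullet> (y - x) - (1 + a) / 2 * (norm q)\<^sup>2 - m / 2 * (norm (y - x))\<^sup>2)"
      using prev T(1) by (cases "T = 1") (auto intro!: mult_left_mono)
    moreover have "T * B \<le> T * (q \<bullet> (y - p) - (1 + a) / 2 * (norm q)\<^sup>2 - m / 2 * (norm (y - p))\<^sup>2)"
      using opt T(1) by simp
    moreover have "q \<bullet> u = (T - 1) * (q \<bullet> (y - x)) + q \<bullet> (y - p)"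
      by (simp add: u inner_simps)
    moreover have "T * (T - 1) * (X - (1 + a) / 2 * N - m / 2 * M) +
        T * (P - (1 + a) / 2 * N - m / 2 * K) =
        T * ((T - 1) * X + P) - (1 + a) * (T\<^sup>2 * N / 2) - m / 2 * (T * (T - 1) * M + T * K)"
      for X P N M K :: real
      by (simp add: field_simps power2_eq_square)
    moreover have "T\<^sup>2 * B - T * (T - 1) * A = T * (T - 1) * (B - A) + T * B"
      by (simp add: algebra_simps power2_eq_square)
    ultimately have "T\<^sup>2 * B - T * (T - 1) * A \<le> T * (q \<bullet> u) - (1 + a) * w
        - m / 2 * (T * (T - 1) * (norm (y - x))\<^sup>2 + T * (norm (y - p))\<^sup>2)"
      unfolding w_def by (smt (verit))
    \<comment> \<open>Convexity of the squared norm: \<open>u\<close> is \<open>T\<close> times the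
      average of \<open>y - x\<close> and \<open>y - p\<close> with weights
      \<open>(T - 1) / T\<close> and \<open>1 / T\<close>.\<close>
    moreover have "2 * v \<le> T * (T - 1) * (norm (y - x))\<^sup>2 + T * (norm (y - p))\<^sup>2"
    proof -
      have "T * (T - 1) * (norm (y - x))\<^sup>2 + T * (norm (y - p))\<^sup>2 - 2 * v =
          (T - 1) * (norm ((y - x) - (y - p)))\<^sup>2"
        unfolding v_def u power2_norm_eq_inner
        by (simp add: inner_simps inner_commute field_simps power2_eq_square)
      then show ?thesis using T(1) by (smt (verit) mult_nonneg_nonneg zero_le_power2)
    qed
    then have "m / 2 * (2 * v) \<le> m / 2 * (T * (T - 1) * (norm (y - x))\<^sup>2 + T * (norm (y - p))\<^sup>2)"
      using m by (intro mult_left_mono) auto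
    ultimately show ?thesis
      unfolding E_def E'_def sq by (simp add: algebra_simps)
  qed
  have upper: "E' \<le> w / m + (1 + 1 / a) * v"
  proof -
    \<comment> \<open>Young's inequality, weighted so that the square of \<open>y - p\<close> is
      absorbed by the strong convexity term in \<open>opt\<close>.\<close>
    have "0 \<le> (norm (q - m *\<^sub>R (y - p)))\<^sup>2 / (2 * m)" using m by simp
    also have "\<dots> = (norm q)\<^sup>2 / (2 * m) - q \<bullet> (y - p) + m / 2 * (norm (y - p))\<^sup>2"
      unfolding power2_norm_eq_inner using m
      by (simp add: inner_simps inner_commute field_simps power2_eq_square)
    finally have "B \<le> (norm q)\<^sup>2 / (2 * m) - (1 + a) / 2 * (norm q)\<^sup>2"
      using opt by linarith
    then have "T\<^sup>2 * B \<le> T\<^sup>2 * ((norm q)\<^sup>2 / (2 * m) - (1 + a) / 2 * (norm q)\<^sup>2)"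
      by (intro mult_left_mono) auto
    then have "T\<^sup>2 * B \<le> w / m - (1 + a) * w"
      using m by (simp add: w_def field_simps)
    moreover have "1 / 2 * (norm (u - T *\<^sub>R q))\<^sup>2 \<le> (1 + 1 / a) * v + (1 + a) * w"
    proof -
      \<comment> \<open>Young's inequality again, weighted by \<open>a\<close> so that the resulting
        \<open>(1 + a) * w\<close> cancels the negative term in the bound on
        \<open>T\<^sup>2 * B\<close>.\<close>
      have "0 \<le> (norm (u + (a * T) *\<^sub>R q))\<^sup>2 / (2 * a)" using a by simp
      also have "\<dots> = v / a + T * (q \<bullet> u) + a * w"
        unfolding power2_norm_eq_inner v_def w_def using a
        by (simp add: inner_simps inner_commute field_simps power2_eq_square)
      finally show ?thesis unfolding sq by (simp add: algebra_simps)
    qed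
    ultimately show ?thesis unfolding E'_def by linarith
  qed
  have am: "0 < a * m" "a * m < 1" "a * m < a"
    using a m mult_strict_mono[of a 1 m 1] by auto
  \<comment> \<open>Multiplying by \<open>a * m\<close> turns the upper bound into
    \<open>a * w + (1 + a) * (m * v)\<close>. Since \<open>a\<close> and \<open>a * m\<close> are
    below 1, \<open>3 - a * m\<close> dominates both 1 and \<open>1 + a\<close>, which is where the
    constant 3 arises; the decrease then gives \<open>3 * E' \<le> (3 - a * m) * E\<close>.\<close>
  have "a * m * E' \<le> a * m * (w / m + (1 + 1 / a) * v)"
    using upper am(1) by (intro mult_left_mono) auto
  also have "\<dots> = a * w + (1 + a) * (m * v)"
    using a m by (simp add: field_simps)
  also have "\<dots> \<le> (3 - a * m) * (a * w) + (3 - a * m) * (m * v)"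
  proof (rule add_mono)
    show "a * w \<le> (3 - a * m) * (a * w)"
      using mult_right_mono[of 1 "3 - a * m" "a * w"] am a wv by simp
    show "(1 + a) * (m * v) \<le> (3 - a * m) * (m * v)"
    proof (intro mult_right_mono)
      show "1 + a \<le> 3 - a * m" using am a by linarith
    qed (use m wv in simp)
  qed
  also have "\<dots> \<le> (3 - a * m) * (E - E')"
    using decrease am mult_left_mono[of "a * w + m * v" "E - E'" "3 - a * m"]
    by (simp add: algebra_simps)
  finally have "E' \<le> (1 - a * m / 3) * E"
    by (simp add: algebra_simps)
  moreover have "(T' - 1) * T' * B \<le> T\<^sup>2 * B"
    using T(3) \<open>0 \<le> B\<close> by (intro mult_right_mono) (auto simp: algebra_simps power2_eq_square)
  ultimately show ?thesis
    by (simp add: E_def E'_def v_def)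
qed

section \<open>Parameter sequences\<close>

lemma nesterov_rule_ge_1:
  assumes "nesterov_rule t" "1 \<le> k"
  shows "1 \<le> t k"
  using assms(2)
proof (induction k rule: dec_induct)
  case base
  then show ?case using assms(1) by (simp add: nesterov_rule_def)
next
  case (step k)
  then have "t k < t (k + 1)" using assms(1) by (simp add: nesterov_rule_def)
  then show ?case using step by simp
qed

lemma nesterov_rule_gt_1:
  assumes "nesterov_rule t" "1 \<le> k"
  shows "1 < t (k + 1)"
  using nesterov_rule_ge_1[OF assms] assms by (fastforce simp: nesterov_rule_def)

lemma filterlim_at_top_linear:
  fixes t :: "nat \<Rightarrow> real"
  assumes "0 < r" "\<And>k. 1 + real k / r \<le> t (k + 1)"
  shows "filterlim t at_top sequentially"
proof -
  have "filterlim (\<lambda>k. 1 + real k / r) at_top sequentially"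
    using assms(1)
    using filterlim_tendsto_pos_mult_at_top[OF tendsto_const[of "1 / r"] _ filterlim_real_sequentially]
    by (intro filterlim_tendsto_add_at_top[OF tendsto_const]) simp
  then have "filterlim (\<lambda>k. t (k + 1)) at_top sequentially"
    by (rule filterlim_at_top_mono) (use assms(2) in auto)
  then show ?thesis
    using filterlim_sequentially_Suc[of t] by simp
qed

text \<open>Each new parameter is a root of \<open>T\<^sup>2 - T = (t k)\<^sup>2\<close>, so the
  rule holds with equality. The root exceeds \<open>t k + 1 / 2\<close>, which yields linear growth
  with slope 1/2.\<close>

lemma nesterov_rule_fista:
  assumes t: "t 1 = 1" "\<And>k. k \<ge> 1 \<Longrightarrow> t (k + 1) = (1 + sqrt (1 + 4 * (t k)\<^sup>2)) / 2"
  shows "nesterov_rule t" and "1 + real k / 2 \<le> t (k + 1)"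
proof -
  have sqrt: "2 * \<bar>x\<bar> < sqrt (1 + 4 * x\<^sup>2)" for x :: real
    by (rule real_less_rsqrt) (simp add: power2_eq_square)
  have step: "t k + 1 / 2 \<le> t (k + 1)" if "k \<ge> 1" for k
    using t(2)[OF that] sqrt[of "t k"] by simp
  show lin: "1 + real k / 2 \<le> t (k + 1)" for k
  proof (induction k)
    case (Suc k)
    then show ?case using step[of "Suc k"] by (simp add: add_divide_distrib)
  qed (use t(1) in simp)
  have "(t (k + 1))\<^sup>2 - t (k + 1) = (t k)\<^sup>2" if "k \<ge> 1" for k
  proof -
    have "(sqrt (1 + 4 * (t k)\<^sup>2))\<^sup>2 = 1 + 4 * (t k)\<^sup>2" by simp
    then show ?thesis
      unfolding t(2)[OF that] by (simp add: power2_eq_square field_simps)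
  qed
  moreover have "t k < t (k + 1)" if "k \<ge> 1" for k
    using step[OF that] by simp
  ultimately show "nesterov_rule t"
    using filterlim_at_top_linear[of 2 t] lin t(1) by (simp add: nesterov_rule_def)
qed

lemma nesterov_rule_linear:
  assumes "2 \<le> r" and t: "\<And>k. t (k + 1) = (real k + r) / r"
  shows "nesterov_rule t" and "1 + real k / r \<le> t (k + 1)"
proof -
  have lin: "t (k + 1) = 1 + real k / r" for k
    using assms by (simp add: field_simps)
  then show "1 + real k / r \<le> t (k + 1)" by simp
  have "t k < t (k + 1) \<and> (t (k + 1))\<^sup>2 - t (k + 1) \<le> (t k)\<^sup>2" if k1: "k \<ge> 1" for k
  proof -
    obtain j where k: "k = j + 1" using k1 by (cases k) auto
    \<comment> \<open>With slope \<open>c\<close>, the slack in the rule is the polynomial computed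
      below; \<open>2 \<le> r\<close> means \<open>c \<le> 1 / 2\<close>, which makes both of its
      parts nonnegative.\<close>
    define c where "c = 1 / r"
    have c: "0 < c" "c \<le> 1 / 2" using assms(1) by (auto simp: c_def field_simps)
    have tk: "t k = 1 + real j * c" "t (k + 1) = 1 + (real j + 1) * c"
      using lin[of j] lin[of k] by (simp_all add: k c_def)
    have "(t k)\<^sup>2 - ((t (k + 1))\<^sup>2 - t (k + 1)) = (1 - c - c\<^sup>2) + real j * c * (1 - 2 * c)"
      unfolding tk by (simp add: algebra_simps power2_eq_square)
    moreover have "c\<^sup>2 \<le> 1 / 4"
      using power_mono[of c "1 / 2" 2] c by (simp add: power2_eq_square)
    moreover have "0 \<le> real j * c * (1 - 2 * c)" using c by simp
    ultimately have "(t (k + 1))\<^sup>2 - t (k + 1) \<le> (t k)\<^sup>2" using c by linarith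
    then show ?thesis using c(1) tk by simp
  qed
  moreover have "filterlim t at_top sequentially"
    using filterlim_at_top_linear[of r t] lin assms(1) by simp
  ultimately show "nesterov_rule t"
    using lin[of 0] by (simp add: nesterov_rule_def)
qed

section \<open>Convergence of the accelerated method\<close>

text \<open>The second alternative covers \<open>k = 0\<close>, where \<open>x 0\<close> may have
  infinite objective value: the coefficient is 0 and \<open>0 * \<infinity> = 0\<close>.\<close>

lemma lyapunov_real:
  assumes g: "proper_fun g" and "xstar \<in> effective_domain g"
    and "x k \<in> effective_domain g \<or> t (k + 1) = 1"
  shows "lyapunov f g s t x y xstar k =
    ereal ((t (k + 1) - 1) * t (k + 1) *
        (s * ((f (x k) + real_of_ereal (g (x k))) - (f xstar + real_of_ereal (g xstar)))) +
      1 / 2 * (norm ((t (k + 1) - 1) *\<^sub>R (y k - x k) + (y k - xstar)))\<^sup>2)"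
proof (cases "t (k + 1) = 1")
  case True
  then show ?thesis by (simp add: lyapunov_def flip: zero_ereal_def)
next
  case False
  then have "x k \<in> effective_domain g" using assms(3) by simp
  then show ?thesis
    by (simp add: lyapunov_def composite_real[OF g] assms(2) mult_ac)
qed

text \<open>The momentum coefficient is such that \<open>t (k + 2)\<close> times
  \<open>y (k + 1) - x (k + 1)\<close> equals \<open>t (k + 1) - 1\<close> times
  \<open>x (k + 1) - x k\<close>. Hence the vector in the Lyapunov function changes only by
  \<open>t (k + 1)\<close> times the proximal gradient step.\<close>

lemma apg_lyapunov_residual:
  assumes "apg_sequence f g s t x y" "t (k + 2) \<noteq> 0"
  shows "(t (k + 2) - 1) *\<^sub>R (y (k + 1) - x (k + 1)) + (y (k + 1) - p) =
    (t (k + 1) - 1) *\<^sub>R (y k - x k) + (y k - p) - t (k + 1) *\<^sub>R (y k - x (k + 1))"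
proof -
  define d where "d = y (k + 1) - x (k + 1)"
  have "t (k + 2) *\<^sub>R d = (t (k + 1) - 1) *\<^sub>R (x (k + 1) - x k)"
    using assms by (simp add: apg_sequence_def d_def)
  moreover have "(t (k + 2) - 1) *\<^sub>R d + (y (k + 1) - p) = t (k + 2) *\<^sub>R d + (x (k + 1) - p)"
    by (simp add: d_def algebra_simps)
  ultimately show ?thesis
    by (simp add: d_def algebra_simps)
qed

lemma apg_iterate_in_effective_domain:
  fixes g :: "'a::euclidean_space \<Rightarrow> ereal"
  assumes "apg_sequence f g s t x y" "0 < s" "closed_fun g" "proper_fun g" "convex_fun g" "1 \<le> k"
  shows "x k \<in> effective_domain g"
proof -
  obtain j where "k = j + 1" using \<open>1 \<le> k\<close> by (cases k) auto
  then show ?thesis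
    using assms prox_in_effective_domain_ineq(1) by (simp add: apg_sequence_def)
qed

text \<open>Instance of the contraction with \<open>T = t (k + 1)\<close>,
  \<open>T' = t (k + 2)\<close>, and \<open>A\<close>, \<open>B\<close> the objective gaps at
  \<open>x k\<close> and \<open>x (k + 1)\<close> multiplied by \<open>s\<close>. Finiteness of both
  Lyapunov values allows the real inequality to be read in the extended reals.\<close>

lemma apg_lyapunov_decrease:
  fixes f :: "'a::euclidean_space \<Rightarrow> real" and g :: "'a \<Rightarrow> ereal"
  assumes "0 < \<mu>" "\<mu> < L" and f: "smooth_with L f" "strongly_convex \<mu> f"
    and g: "closed_fun g" "proper_fun g" "convex_fun g"
    and min: "is_arg_min (composite f g) (\<lambda>_. True) xstar"
    and s: "0 < s" "L * s < 1"
    and apg: "apg_sequence f g s t x y" and t: "nesterov_rule t"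
  shows "lyapunov f g s t x y xstar (k + 1) \<le>
    ereal (1 - (1 - L * s) * \<mu> * s / 3) * lyapunov f g s t x y xstar k"
proof -
  define \<phi> where "\<phi> z = f z + real_of_ereal (g z)" for z
  note opt = min[unfolded is_arg_min_composite_iff[OF g(2)], folded \<phi>_def]
  have dom: "x j \<in> effective_domain g" if "1 \<le> j" for j
    using apg_iterate_in_effective_domain[OF apg s(1) g that] .
  have x': "x (k + 1) = prox s g (y k - s *\<^sub>R gradient f (y k))"
    using apg by (simp add: apg_sequence_def)
  have step: "s * (\<phi> (x (k + 1)) - \<phi> z) \<le> (y k - x (k + 1)) \<bullet> (y k - z) -
      (1 + (1 - L * s)) / 2 * (norm (y k - x (k + 1)))\<^sup>2 - \<mu> * s / 2 * (norm (y k - z))\<^sup>2"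
    if "z \<in> effective_domain g" for z
    using prox_gradient_inequality[OF f g s(1) x' that] unfolding \<phi>_def by (simp add: field_simps)
  have xk: "x k \<in> effective_domain g \<or> t (k + 1) = 1"
    using dom[of k] t by (cases k) (auto simp: nesterov_rule_def)
  have ls: "0 < L * s" and ms: "0 < \<mu> * s" "\<mu> * s < 1"
    using assms(1,2) s less_trans[OF mult_strict_right_mono[of \<mu> L s] s(2)] by auto
  have t1: "1 \<le> t (k + 1)" "1 \<le> t (k + 2)"
    using nesterov_rule_ge_1[OF t] by auto
  have t2: "(t (k + 2))\<^sup>2 - t (k + 2) \<le> (t (k + 1))\<^sup>2"
    using t[unfolded nesterov_rule_def] by (metis add.assoc le_add2 one_add_one)
  have "(t (k + 2) - 1) * t (k + 2) * (s * (\<phi> (x (k + 1)) - \<phi> xstar)) +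
      1 / 2 * (norm ((t (k + 1) - 1) *\<^sub>R (y k - x k) + (y k - xstar) - t (k + 1) *\<^sub>R (y k - x (k + 1))))\<^sup>2
    \<le> (1 - (1 - L * s) * (\<mu> * s) / 3) *
      ((t (k + 1) - 1) * t (k + 1) * (s * (\<phi> (x k) - \<phi> xstar)) +
       1 / 2 * (norm ((t (k + 1) - 1) *\<^sub>R (y k - x k) + (y k - xstar)))\<^sup>2)"
  proof (rule lyapunov_contraction[OF _ _ ms t1 t2])
    show "0 \<le> s * (\<phi> (x (k + 1)) - \<phi> xstar)"
      using opt dom s(1) by simp
    show "s * (\<phi> (x (k + 1)) - \<phi> xstar) - s * (\<phi> (x k) - \<phi> xstar) \<le>
        (y k - x (k + 1)) \<bullet> (y k - x k) - (1 + (1 - L * s)) / 2 * (norm (y k - x (k + 1)))\<^sup>2 -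
        \<mu> * s / 2 * (norm (y k - x k))\<^sup>2" if "1 < t (k + 1)"
      using step[of "x k"] xk that by (simp add: right_diff_distrib)
    show "s * (\<phi> (x (k + 1)) - \<phi> xstar) \<le>
        (y k - x (k + 1)) \<bullet> (y k - xstar) - (1 + (1 - L * s)) / 2 * (norm (y k - x (k + 1)))\<^sup>2 -
        \<mu> * s / 2 * (norm (y k - xstar))\<^sup>2"
      using step opt by blast
  qed (use s ls in auto)
  moreover have "lyapunov f g s t x y xstar (k + 1) = ereal (
      (t (k + 2) - 1) * t (k + 2) * (s * (\<phi> (x (k + 1)) - \<phi> xstar)) +
      1 / 2 * (norm ((t (k + 1) - 1) *\<^sub>R (y k - x k) + (y k - xstar) - t (k + 1) *\<^sub>R (y k - x (k + 1))))\<^sup>2)"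
  proof -
    have "t (k + 2) \<noteq> 0" "k + 1 + 1 = k + 2" using t1 by auto
    then show ?thesis
      using lyapunov_real[OF g(2), of xstar x "k + 1" t f s y] dom[of "k + 1"] opt
      by (simp only: apg_lyapunov_residual[OF apg, of k xstar] \<phi>_def not_False_eq_True le_add2
        simp_thms)
  qed
  moreover have "lyapunov f g s t x y xstar k = ereal (
      (t (k + 1) - 1) * t (k + 1) * (s * (\<phi> (x k) - \<phi> xstar)) +
      1 / 2 * (norm ((t (k + 1) - 1) *\<^sub>R (y k - x k) + (y k - xstar)))\<^sup>2)"
    using lyapunov_real[OF g(2), of xstar x k t f s y] xk opt by (simp only: \<phi>_def simp_thms)
  ultimately show ?thesis
    by (simp only: times_ereal.simps ereal_less_eq mult.assoc)
qed

text \<open>Iterating the decrease from the initial value, where \<open>t 1 = 1\<close> removes the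
  objective gap and \<open>y 0 = x 0\<close> leaves half the squared distance, bounds the Lyapunov
  value at \<open>k\<close>. Its squared norm is then dropped; the divisor is positive because
  \<open>t (k + 1) > 1\<close>.\<close>

lemma apg_rate:
  fixes f :: "'a::euclidean_space \<Rightarrow> real" and g :: "'a \<Rightarrow> ereal"
  assumes "0 < \<mu>" "\<mu> < L" and f: "smooth_with L f" "strongly_convex \<mu> f"
    and g: "closed_fun g" "proper_fun g" "convex_fun g"
    and min: "is_arg_min (composite f g) (\<lambda>_. True) xstar"
    and s: "0 < s" "L * s < 1"
    and apg: "apg_sequence f g s t x y" and t: "nesterov_rule t"
    and \<rho>: "\<rho> = 1 - (1 - L * s) * \<mu> * s / 3" "0 \<le> \<rho>" and "1 \<le> k"
  shows "composite f g (x k) - composite f g xstar \<le>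
    ereal (\<rho> ^ k * (norm (x 0 - xstar))\<^sup>2 / (2 * s * (t (k + 1) - 1) * t (k + 1)))"
proof -
  define \<phi> where "\<phi> z = f z + real_of_ereal (g z)" for z
  let ?E = "lyapunov f g s t x y xstar"
  have xstar: "xstar \<in> effective_domain g"
    using min by (simp add: is_arg_min_composite_iff[OF g(2)])
  have xk: "x k \<in> effective_domain g"
    using apg_iterate_in_effective_domain[OF apg s(1) g \<open>1 \<le> k\<close>] .
  have "?E j \<le> ereal (\<rho> ^ j * (1 / 2 * (norm (x 0 - xstar))\<^sup>2))" for j
  proof (induction j)
    case 0
    have "t 1 = 1" "y 0 = x 0"
      using t apg by (auto simp: nesterov_rule_def apg_sequence_def)
    then show ?case by (simp add: lyapunov_def flip: zero_ereal_def)
  next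
    case (Suc j)
    have "?E (Suc j) \<le> ereal \<rho> * ?E j"
      using apg_lyapunov_decrease[OF assms(1,2) f g min s apg t, of j] by (simp add: \<rho>(1))
    also have "\<dots> \<le> ereal \<rho> * ereal (\<rho> ^ j * (1 / 2 * (norm (x 0 - xstar))\<^sup>2))"
      using Suc \<rho>(2) by (intro ereal_mult_left_mono) auto
    finally show ?case by (simp add: mult.assoc)
  qed
  from this[of k] have "(t (k + 1) - 1) * t (k + 1) * (s * (\<phi> (x k) - \<phi> xstar)) +
      1 / 2 * (norm ((t (k + 1) - 1) *\<^sub>R (y k - x k) + (y k - xstar)))\<^sup>2 \<le>
      \<rho> ^ k * (1 / 2 * (norm (x 0 - xstar))\<^sup>2)"
    using lyapunov_real[OF g(2) xstar, of x k t] xk by (simp add: \<phi>_def)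
  then have "(t (k + 1) - 1) * t (k + 1) * (s * (\<phi> (x k) - \<phi> xstar)) \<le>
      \<rho> ^ k * (1 / 2 * (norm (x 0 - xstar))\<^sup>2)"
    by (rule order_trans[rotated]) simp
  moreover have "0 < 2 * s * (t (k + 1) - 1) * t (k + 1)"
    using nesterov_rule_gt_1[OF t \<open>1 \<le> k\<close>] s(1) by simp
  ultimately have "\<phi> (x k) - \<phi> xstar \<le>
      \<rho> ^ k * (norm (x 0 - xstar))\<^sup>2 / (2 * s * (t (k + 1) - 1) * t (k + 1))"
    by (subst pos_le_divide_eq) (simp_all add: algebra_simps)
  then show ?thesis
    using xk xstar by (simp add: composite_real[OF g(2)] \<phi>_def)
qed

text \<open>Both \<open>t (k + 1) - 1\<close> and \<open>t (k + 1)\<close> are at least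
  \<open>k / r\<close>, so the denominator grows at least quadratically.\<close>

lemma quadratic_rate_of_linear_parameters:
  fixes t :: "nat \<Rightarrow> real"
  assumes "0 < s" "0 < r" "0 \<le> c" "1 \<le> k" "1 + real k / r \<le> t (k + 1)"
  shows "c / (2 * s * (t (k + 1) - 1) * t (k + 1)) \<le> r\<^sup>2 * c / (2 * s) / (real k)\<^sup>2"
proof -
  have "(real k / r) * (real k / r) \<le> (t (k + 1) - 1) * t (k + 1)"
  proof (intro mult_mono)
    have "0 \<le> real k / r" using \<open>0 < r\<close> by simp
    then show "real k / r \<le> t (k + 1) - 1" "real k / r \<le> t (k + 1)" "0 \<le> t (k + 1) - 1" "0 \<le> real k / r"
      using assms(5) by linarith+
  qed
  then have "2 * s * ((real k)\<^sup>2 / r\<^sup>2) \<le> 2 * s * (t (k + 1) - 1) * t (k + 1)"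
    using \<open>0 < s\<close> mult_left_mono[of "real k / r * (real k / r)" "(t (k + 1) - 1) * t (k + 1)" "2 * s"]
    by (simp add: power2_eq_square mult.assoc)
  then have "c / (2 * s * (t (k + 1) - 1) * t (k + 1)) \<le> c / (2 * s * ((real k)\<^sup>2 / r\<^sup>2))"
    using assms(1-4) by (intro frac_le) auto
  then show ?thesis by (simp add: field_simps)
qed

theorem theorem1:
  fixes f :: "real ^ 'n \<Rightarrow> real" and g :: "real ^ 'n \<Rightarrow> ereal"
    and L \<mu> s \<rho> :: real and t :: "nat \<Rightarrow> real"
    and x y :: "nat \<Rightarrow> real ^ 'n" and xstar :: "real ^ 'n"
  assumes "0 < \<mu>" and "\<mu> < L"
    and "smooth_with L f" and "strongly_convex \<mu> f"
    and "closed_fun g" and "proper_fun g" and "convex_fun g"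
    and "xstar = arg_min (composite f g) (\<lambda>_. True)"
    and "0 < s" and "s < 1 / L"
    and "apg_sequence f g s t x y"
    and "\<rho> = 1 - (1 - L * s) * \<mu> * s / 3"
  shows "(\<exists>!z. is_arg_min (composite f g) (\<lambda>_. True) z) \<and>
    1 - \<mu> * s < \<rho> \<and> \<rho> < 1 \<and>
    (nesterov_rule t \<longrightarrow>
      (\<forall>k. lyapunov f g s t x y xstar (k + 1) \<le> ereal \<rho> * lyapunov f g s t x y xstar k) \<and>
      (\<forall>k\<ge>1. composite f g (x k) - composite f g xstar \<le>
        ereal (\<rho> ^ k * (norm (x 0 - xstar))\<^sup>2 / (2 * s * (t (k + 1) - 1) * t (k + 1))))) \<and>
    ((t 1 = 1 \<and> (\<forall>k\<ge>1. t (k + 1) = (1 + sqrt (1 + 4 * (t k)\<^sup>2)) / 2)) \<or>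
      (\<exists>r::real. r \<ge> 2 \<and> (\<forall>k. t (k + 1) = (real k + r) / r)) \<longrightarrow>
      (\<exists>C::real. \<forall>k\<ge>1. composite f g (x k) - composite f g xstar \<le>
        ereal (C * \<rho> ^ k / (real k)\<^sup>2)))"
proof -
  have L: "0 < L" using assms(1,2) by simp
  have s: "0 < s" "L * s < 1"
    using assms(9,10) L by (auto simp: field_simps)
  have "f differentiable_on UNIV"
    using assms(3) by (simp add: smooth_with_def differentiable_on_def)
  then have ex1: "\<exists>!z. is_arg_min (composite f g) (\<lambda>_. True) z"
    using assms by (intro strongly_convex_composite_ex1_min[of f \<mu>]) (auto intro: differentiable_imp_continuous_on)
  then have min: "is_arg_min (composite f g) (\<lambda>_. True) xstar"
    unfolding assms(8) by (rule ex1_is_arg_min_arg_min)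
  have "0 < L * s" "0 < \<mu> * s" "\<mu> * s < 1"
    using assms(1,2) L s less_trans[OF mult_strict_right_mono[of \<mu> L s] s(2)] by auto
  \<comment> \<open>\<open>\<mu> * s < L * s < 1\<close>, so \<open>1 - \<rho>\<close> is one third
    of a positive number at most \<open>\<mu> * s\<close>; this gives both bounds on \<rho> and its
    nonnegativity.\<close>
  then have am: "0 < (1 - L * s) * (\<mu> * s)" "(1 - L * s) * (\<mu> * s) \<le> \<mu> * s"
    using s by (auto intro: mult_left_le_one_le)
  then have \<rho>: "1 - \<mu> * s < \<rho>" "\<rho> < 1" "0 \<le> \<rho>"
    using \<open>0 < \<mu> * s\<close> \<open>\<mu> * s < 1\<close> unfolding assms(12) mult.assoc by linarith+
  have rate: "composite f g (x k) - composite f g xstar \<le>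
      ereal (\<rho> ^ k * (norm (x 0 - xstar))\<^sup>2 / (2 * s * (t (k + 1) - 1) * t (k + 1)))"
    if "nesterov_rule t" "1 \<le> k" for k
    using apg_rate[OF assms(1-7) min s assms(11) that(1) assms(12) \<rho>(3) that(2)] .
  have big_O: "\<exists>C::real. \<forall>k\<ge>1. composite f g (x k) - composite f g xstar \<le>
      ereal (C * \<rho> ^ k / (real k)\<^sup>2)"
    if t: "nesterov_rule t" and "0 < r" and lin: "\<And>k. 1 + real k / r \<le> t (k + 1)" for r
  proof (intro exI[of _ "r\<^sup>2 * (norm (x 0 - xstar))\<^sup>2 / (2 * s)"] allI impI)
    fix k :: nat assume k: "1 \<le> k"
    have "\<rho> ^ k * (norm (x 0 - xstar))\<^sup>2 / (2 * s * (t (k + 1) - 1) * t (k + 1)) \<le>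
        r\<^sup>2 * (\<rho> ^ k * (norm (x 0 - xstar))\<^sup>2) / (2 * s) / (real k)\<^sup>2"
      using \<rho>(3) quadratic_rate_of_linear_parameters[of s r _ k t] s(1) \<open>0 < r\<close> k lin[of k] by simp
    then have "\<rho> ^ k * (norm (x 0 - xstar))\<^sup>2 / (2 * s * (t (k + 1) - 1) * t (k + 1)) \<le>
        r\<^sup>2 * (norm (x 0 - xstar))\<^sup>2 / (2 * s) * \<rho> ^ k / (real k)\<^sup>2"
      by (simp add: mult_ac)
    then show "composite f g (x k) - composite f g xstar \<le>
        ereal (r\<^sup>2 * (norm (x 0 - xstar))\<^sup>2 / (2 * s) * \<rho> ^ k / (real k)\<^sup>2)"
      using order_trans[OF rate[OF t k]] by simp
  qed
  show ?thesis
  proof (intro conjI impI)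
    assume t: "nesterov_rule t"
    show "\<forall>k. lyapunov f g s t x y xstar (k + 1) \<le> ereal \<rho> * lyapunov f g s t x y xstar k"
      unfolding assms(12) using apg_lyapunov_decrease[OF assms(1-7) min s assms(11) t] by blast
  next
    assume "(t 1 = 1 \<and> (\<forall>k\<ge>1. t (k + 1) = (1 + sqrt (1 + 4 * (t k)\<^sup>2)) / 2)) \<or>
      (\<exists>r::real. r \<ge> 2 \<and> (\<forall>k. t (k + 1) = (real k + r) / r))"
    then show "\<exists>C::real. \<forall>k\<ge>1. composite f g (x k) - composite f g xstar \<le>
        ereal (C * \<rho> ^ k / (real k)\<^sup>2)"
    proof (elim disjE exE conjE)
      assume "t 1 = 1" "\<forall>k\<ge>1. t (k + 1) = (1 + sqrt (1 + 4 * (t k)\<^sup>2)) / 2"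
      then show ?thesis
        \<comment> \<open>The value 2 is the reciprocal of the growth slope 1/2 of this
          sequence.\<close>
        using big_O[of 2] nesterov_rule_fista[of t] by auto
    next
      fix r :: real assume "2 \<le> r" "\<forall>k. t (k + 1) = (real k + r) / r"
      then show ?thesis
        using big_O[of r] nesterov_rule_linear[of r t] by auto
    qed
  qed (use ex1 \<rho> rate in auto)
qed

end
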